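(* Let $D$ be a Seymour-tight orientation on $n$ vertices. Let $G_1,\ldots,G_n$ be a sequence of Seymour-tight orientations, each on $k$ vertices. Then the generalized lexicographic product $D[G_1,\ldots,G_n]$ is also a Seymour-tight orientation.
   Context: All directed graphs are finite, with non-empty vertex set, and without loops or multiple arcs. An orientation is a directed graph with no directed cycle of length 2. For a directed graph $G$ and $v\in V(G)$, $N_1(G,v)=\{w : (v,w)\in E(G)\}$ and $N_2(G,v)=\{w\in V(G)\setminus(N_1(G,v)\cup\{v\}) : \exists u\in N_1(G,v),\ (u,w)\in E(G)\}$. An orientation $G$ is Seymour-tight if $|N_1(G,v)|=|N_2(G,v)|$ for all $v\in V(G)$. For a directed graph $D$ with $V(D)=[n]=\{1,\dots,n\}$ and directed graphs $G_1,\dots,G_n$, the generalized lexicographic product $D[G_1,\dots,G_n]$ has vertex set $\{(i,v): i\in[n],\ v\in V(G_i)\}$, with an arc from $(i,v)$ to $(j,w)$ iff $(i,j)\in E(D)$, or $i=j$ and $(v,w)\in E(G_i)$. *)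

theory Defs
  imports "Graph_Theory.Pair_Digraph"
begin

text \<open>
  A \<^const>\<open>pair_digraph\<close> is finite, loopfree and, its arcs being pairs of vertices, has no
  multiple arcs; it may be the null graph, so non-emptiness is imposed separately.
\<close>

definition orientation :: "'a pair_pre_digraph \<Rightarrow> bool" where
  "orientation G \<longleftrightarrow> pair_digraph G \<and> pverts G \<noteq> {} \<and>
     \<not> (\<exists>p. pre_digraph.cycle (with_proj G) p \<and> length p = 2)"

definition N1 :: "'a pair_pre_digraph \<Rightarrow> 'a \<Rightarrow> 'a set" where
  "N1 G v = {w. (v, w) \<in> parcs G}"

definition N2 :: "'a pair_pre_digraph \<Rightarrow> 'a \<Rightarrow> 'a set" where
  "N2 G v = {w \<in> pverts G - (N1 G v \<union> {v}). \<exists>u \<in> N1 G v. (u, w) \<in> parcs G}"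

definition seymour_tight :: "'a pair_pre_digraph \<Rightarrow> bool" where
  "seymour_tight G \<longleftrightarrow> (\<forall>v \<in> pverts G. card (N1 G v) = card (N2 G v))"

definition gen_lex_prod ::
    "nat pair_pre_digraph \<Rightarrow> (nat \<Rightarrow> 'a pair_pre_digraph) \<Rightarrow> (nat \<times> 'a) pair_pre_digraph" where
  "gen_lex_prod D G =
    (let V = {(i, v). i \<in> pverts D \<and> v \<in> pverts (G i)}
     in \<lparr> pverts = V,
          parcs = {((i, v), (j, w)) | i v j w. (i, v) \<in> V \<and> (j, w) \<in> V \<and>
                     ((i, j) \<in> parcs D \<or> (i = j \<and> (v, w) \<in> parcs (G i)))} \<rparr>)"

text \<open>
  The 2-cycle condition, stated with the library's notion of cycle, says that no two arcs
  are antiparallel.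
\<close>

lemma orientation_iff:
  "orientation G \<longleftrightarrow> pair_digraph G \<and> pverts G \<noteq> {} \<and>
     (\<forall>u v. (u, v) \<in> parcs G \<longrightarrow> (v, u) \<notin> parcs G)"
proof (cases "pair_digraph G")
  case True
  then interpret pair_digraph G .
  have "(\<exists>p. cycle p \<and> length p = 2) \<longleftrightarrow> (\<exists>u v. (u, v) \<in> parcs G \<and> (v, u) \<in> parcs G)"
    (is "?L \<longleftrightarrow> ?R")
  proof
    assume ?L
    then obtain p u where p: "length p = 2" "awalk u p u"
      unfolding cycle_def by blast
    then obtain e f where "p = [e, f]"
      by (auto simp: numeral_2_eq_2 length_Suc_conv)
    with p show ?R
      by (cases e; cases f) (auto simp: awalk_def)
  next
    assume ?R
    then obtain u v where uv: "(u, v) \<in> parcs G" "(v, u) \<in> parcs G" by blast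
    then have "u \<noteq> v" by (auto dest: no_loops')
    with uv have "cycle [(u, v), (v, u)]"
      unfolding cycle_def by (auto simp: awalk_def intro: in_arcsD1)
    then show ?L
      by (intro exI[of _ "[(u, v), (v, u)]"]) simp
  qed
  with True show ?thesis
    unfolding orientation_def by auto
qed (simp add: orientation_def)

end

theory Submission
  imports Defs
begin

text \<open>Call the copy of \<open>G i\<close> in the product the fibre over \<open>i\<close>. An
  arc (i, j) of \<open>D\<close> joins every vertex of fibre \<open>i\<close> to every vertex of
  fibre \<open>j\<close>, so \<open>N1\<close> of (i, v) consists of the whole fibres over
  \<open>N1 D i\<close> and a copy of \<open>N1 (G i) v\<close> in fibre \<open>i\<close>. The heart
  of the proof, \<open>N2_gen_lex_prod\<close>, is that \<open>N2\<close> of (i, v) has the same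
  shape with \<open>N2\<close> for \<open>N1\<close>. All fibres have \<open>k\<close> vertices, so
  for m = 1, 2 the m-th neighbourhood has |Nm(D, i)| * k + |Nm(G i, v)| elements
  (\<open>card_fibres_Un\<close>), and tightness of \<open>D\<close> and of \<open>G i\<close>
  equates the two counts.\<close>

lemma orientation_arcD:
  assumes "orientation G" and "(u, v) \<in> parcs G"
  shows "u \<in> pverts G" and "v \<in> pverts G" and "(v, u) \<notin> parcs G"
proof -
  interpret pair_digraph G using assms(1) by (simp add: orientation_def)
  show "u \<in> pverts G" "v \<in> pverts G"
    using assms(2) by (auto dest: in_arcsD1 in_arcsD2)
  show "(v, u) \<notin> parcs G"
    using assms by (auto simp: orientation_iff)
qed

lemma orientation_finite: "orientation G \<Longrightarrow> finite (pverts G)"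
  by (auto simp: orientation_def pair_digraph_def pair_fin_digraph_def pair_fin_digraph_axioms_def)

text \<open>A loop is its own reverse, so the last assumption also yields loop-freeness.\<close>

lemma orientationI:
  assumes "finite (pverts G)" and "pverts G \<noteq> {}"
    and "\<And>u v. (u, v) \<in> parcs G \<Longrightarrow> u \<in> pverts G \<and> v \<in> pverts G"
    and "\<And>u v. (u, v) \<in> parcs G \<Longrightarrow> (v, u) \<notin> parcs G"
  shows "orientation G"
proof -
  have "finite (parcs G)"
    by (rule finite_subset[OF _ finite_cartesian_product[OF assms(1) assms(1)]])
      (use assms(3) in auto)
  then have "pair_digraph G"
    using assms(1,3,4) by unfold_locales (auto, blast)
  with assms show ?thesis
    by (simp add: orientation_iff)
qed

lemma N1_subset_pverts: "orientation G \<Longrightarrow> N1 G v \<subseteq> pverts G"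
  by (auto simp: N1_def dest: orientation_arcD)

lemma N2_subset_pverts: "N2 G v \<subseteq> pverts G"
  by (auto simp: N2_def)

lemma N2I:
  assumes "w \<in> pverts G" and "w \<notin> N1 G v" and "w \<noteq> v" and "u \<in> N1 G v" and "(u, w) \<in> parcs G"
  shows "w \<in> N2 G v"
  using assms by (auto simp: N2_def)

lemma pverts_gen_lex_prod: "pverts (gen_lex_prod D G) = (SIGMA i:pverts D. pverts (G i))"
  by (auto simp: gen_lex_prod_def Let_def)

lemma parcs_gen_lex_prod_iff:
  "((i, v), (j, w)) \<in> parcs (gen_lex_prod D G) \<longleftrightarrow>
     i \<in> pverts D \<and> v \<in> pverts (G i) \<and> j \<in> pverts D \<and> w \<in> pverts (G j) \<and>
     ((i, j) \<in> parcs D \<or> i = j \<and> (v, w) \<in> parcs (G i))"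
  by (auto simp: gen_lex_prod_def Let_def)

text \<open>Two antiparallel arcs between different fibres would project to antiparallel arcs of
  \<open>D\<close>; inside one fibre they would be antiparallel in \<open>G i\<close>, since
  \<open>D\<close> has no loop at \<open>i\<close>.\<close>

lemma orientation_gen_lex_prod:
  assumes D: "orientation D" and G: "\<And>i. i \<in> pverts D \<Longrightarrow> orientation (G i)"
  shows "orientation (gen_lex_prod D G)"
proof (rule orientationI)
  show "finite (pverts (gen_lex_prod D G))"
    using D G by (auto simp: pverts_gen_lex_prod intro: orientation_finite)
  show "pverts (gen_lex_prod D G) \<noteq> {}"
    using D G by (fastforce simp: pverts_gen_lex_prod orientation_def)
next
  fix x y assume "(x, y) \<in> parcs (gen_lex_prod D G)"
  then show "x \<in> pverts (gen_lex_prod D G) \<and> y \<in> pverts (gen_lex_prod D G)"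
    and "(y, x) \<notin> parcs (gen_lex_prod D G)"
    by (cases x; cases y; auto simp: pverts_gen_lex_prod parcs_gen_lex_prod_iff
        dest: orientation_arcD(3)[OF D] orientation_arcD(3)[OF G])+
qed

context
  fixes D :: "nat pair_pre_digraph" and G :: "nat \<Rightarrow> 'a pair_pre_digraph"
  assumes D: "orientation D" and G: "\<And>i. i \<in> pverts D \<Longrightarrow> orientation (G i)"
begin

lemma N1_gen_lex_prod:
  assumes "i \<in> pverts D" and "v \<in> pverts (G i)"
  shows "N1 (gen_lex_prod D G) (i, v) =
    (SIGMA j:N1 D i. pverts (G j)) \<union> {i} \<times> N1 (G i) v"
  using assms
  by (auto simp: N1_def parcs_gen_lex_prod_iff dest: orientation_arcD(2)[OF D] orientation_arcD(2)[OF G])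

text \<open>
  A 2-step walk from fibre \<open>i\<close> back to fibre \<open>i\<close> stays inside the fibre, because \<open>D\<close> has no
  antiparallel arcs; a fibre over a second neighbour of \<open>i\<close> is reached completely, because the
  intermediate fibre is non-empty.
\<close>

lemma N2_gen_lex_prod:
  assumes i: "i \<in> pverts D" and v: "v \<in> pverts (G i)"
  shows "N2 (gen_lex_prod D G) (i, v) =
    (SIGMA j:N2 D i. pverts (G j)) \<union> {i} \<times> N2 (G i) v"
proof (intro equalityI subsetI)
  fix x
  assume "x \<in> N2 (gen_lex_prod D G) (i, v)"
  \<comment> \<open>A 2-step walk with one step along an arc of \<open>D\<close> and the other
    inside a fibre ends in a fibre over \<open>N1 D i\<close>, hence in \<open>N1\<close>, which is
    excluded. So both steps are of the same kind.\<close>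
  then show "x \<in> (SIGMA j:N2 D i. pverts (G j)) \<union> {i} \<times> N2 (G i) v"
    using i v
    by (cases x) (auto simp: N2_def N1_def pverts_gen_lex_prod parcs_gen_lex_prod_iff
        dest: orientation_arcD(3)[OF D])
next
  fix x
  assume "x \<in> (SIGMA j:N2 D i. pverts (G j)) \<union> {i} \<times> N2 (G i) v"
  then consider (base) j w l where "x = (j, w)" "j \<in> N2 D i" "w \<in> pverts (G j)"
      "(i, l) \<in> parcs D" "(l, j) \<in> parcs D"
    | (fibre) w u where "x = (i, w)" "w \<in> N2 (G i) v" "(v, u) \<in> parcs (G i)" "(u, w) \<in> parcs (G i)"
    unfolding N2_def N1_def by blast
  then show "x \<in> N2 (gen_lex_prod D G) (i, v)"
  proof cases
    case base
    have l: "l \<in> pverts D"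
      using base(4) by (rule orientation_arcD(2)[OF D])
    then obtain u where "u \<in> pverts (G l)"
      using G[OF l] by (auto simp: orientation_def)
    with base l i v have "(l, u) \<in> N1 (gen_lex_prod D G) (i, v)"
      and "((l, u), x) \<in> parcs (gen_lex_prod D G)"
      by (auto simp: N1_def N2_def parcs_gen_lex_prod_iff)
    \<comment> \<open>Membership of \<open>j\<close> in \<open>N2 D i\<close> gives j \<noteq> i and
      excludes \<open>j\<close> from \<open>N1 D i\<close>, so \<open>x\<close> misses both parts of
      \<open>N1\<close>.\<close>
    moreover have "x \<in> pverts (gen_lex_prod D G)"
      and "x \<notin> N1 (gen_lex_prod D G) (i, v)" and "x \<noteq> (i, v)"
      using base i v orientation_arcD(3)[OF D base(4)]
      by (auto simp: N1_gen_lex_prod N2_def pverts_gen_lex_prod)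
    ultimately show ?thesis
      by (intro N2I)
  next
    case fibre
    have "(i, u) \<in> N1 (gen_lex_prod D G) (i, v)" and "((i, u), x) \<in> parcs (gen_lex_prod D G)"
      using fibre i v
      by (auto simp: N1_def N2_def parcs_gen_lex_prod_iff dest: orientation_arcD(2)[OF G[OF i]])
    \<comment> \<open>Since \<open>D\<close> has no loop at \<open>i\<close>, an arc from (i, v) to
      (i, w) could only come from \<open>G i\<close>, where \<open>w\<close> is not an out-neighbour
      of \<open>v\<close>.\<close>
    moreover have "x \<in> pverts (gen_lex_prod D G)"
      and "x \<notin> N1 (gen_lex_prod D G) (i, v)" and "x \<noteq> (i, v)"
      using fibre i v
      by (auto simp: N2_def N1_def pverts_gen_lex_prod parcs_gen_lex_prod_iff
          dest: orientation_arcD(3)[OF D])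
    ultimately show ?thesis
      by (intro N2I)
  qed
qed

end

text \<open>Serves both neighbourhoods, with \<open>I\<close> a neighbourhood of \<open>i\<close> in
  \<open>D\<close> and \<open>B\<close> one of \<open>v\<close> in \<open>G i\<close>; the two
  pieces are disjoint because their first coordinates differ.\<close>

lemma card_fibres_Un:
  assumes "finite I" and "\<And>j. j \<in> I \<Longrightarrow> finite (A j)" and "\<And>j. j \<in> I \<Longrightarrow> card (A j) = k"
    and "i \<notin> I" and "finite B"
  shows "card ((SIGMA j:I. A j) \<union> {i} \<times> B) = card I * k + card B"
proof -
  have "card ((SIGMA j:I. A j) \<union> {i} \<times> B) = card (SIGMA j:I. A j) + card ({i} \<times> B)"
    using assms by (intro card_Un_disjoint) auto
  with assms show ?thesis
    by (simp add: card_cartesian_product)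
qed

lemma seymour_tight_gen_lex_prod:
  assumes D: "orientation D" "seymour_tight D"
    and G: "\<And>i. i \<in> pverts D \<Longrightarrow> orientation (G i)"
      "\<And>i. i \<in> pverts D \<Longrightarrow> seymour_tight (G i)"
    and k: "\<And>i. i \<in> pverts D \<Longrightarrow> card (pverts (G i)) = k"
  shows "seymour_tight (gen_lex_prod D G)"
  unfolding seymour_tight_def
proof
  fix x assume "x \<in> pverts (gen_lex_prod D G)"
  then obtain i v where x: "x = (i, v)" and i: "i \<in> pverts D" and v: "v \<in> pverts (G i)"
    by (auto simp: pverts_gen_lex_prod)
  have nbhd:
    "N1 (gen_lex_prod D G) (i, v) = (SIGMA j:N1 D i. pverts (G j)) \<union> {i} \<times> N1 (G i) v"
    "N2 (gen_lex_prod D G) (i, v) = (SIGMA j:N2 D i. pverts (G j)) \<union> {i} \<times> N2 (G i) v"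
    using N1_gen_lex_prod[of D G i v] N2_gen_lex_prod[of D G i v] D(1) G(1) i v by simp_all
  have card_eq: "card ((SIGMA j:I. pverts (G j)) \<union> {i} \<times> B) = card I * k + card B"
    if "I \<subseteq> pverts D" "i \<notin> I" "B \<subseteq> pverts (G i)" for I B
    using that i k orientation_finite[OF D(1)] orientation_finite[OF G(1)]
    by (intro card_fibres_Un) (auto intro: finite_subset)
  have "card (N1 (gen_lex_prod D G) x) = card (N1 D i) * k + card (N1 (G i) v)"
    unfolding x nbhd(1)
    \<comment> \<open>That \<open>i\<close> is not in \<open>N1 D i\<close> is again loop-freeness,
      a loop being its own reverse; for \<open>N2\<close> below it is part of the
      definition.\<close>
    by (intro card_eq N1_subset_pverts D G i) (auto simp: N1_def dest: orientation_arcD(3)[OF D(1)])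
  also have "\<dots> = card (N2 D i) * k + card (N2 (G i) v)"
    using D(2) G(2)[OF i] i v by (simp add: seymour_tight_def)
  also have "\<dots> = card (N2 (gen_lex_prod D G) x)"
    unfolding x nbhd(2)
    by (intro card_eq[symmetric] N2_subset_pverts) (auto simp: N2_def)
  finally show "card (N1 (gen_lex_prod D G) x) = card (N2 (gen_lex_prod D G) x)" .
qed

theorem corollary4p4:
  fixes n k :: nat
    and D :: "nat pair_pre_digraph"
    and G :: "nat \<Rightarrow> 'a pair_pre_digraph"
  assumes "pverts D = {1..n}"
    and "orientation D" and "seymour_tight D"
    and "\<And>i. i \<in> {1..n} \<Longrightarrow> orientation (G i)"
    and "\<And>i. i \<in> {1..n} \<Longrightarrow> seymour_tight (G i)"
    and "\<And>i. i \<in> {1..n} \<Longrightarrow> card (pverts (G i)) = k"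
  shows "orientation (gen_lex_prod D G) \<and> seymour_tight (gen_lex_prod D G)"
  using orientation_gen_lex_prod[of D G] seymour_tight_gen_lex_prod[of D G k] assms
  by simp

end
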